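(* Let $N=\{1,\dots,n\}$ be a finite player set and let $\alpha>0$. A standard cooperative game $v\colon 2^N\to\mathbb R$ on $N$ is $\alpha$-top dominant if and only if $g^\alpha(v)\in C(v)$.
   Context: A cooperative game on $N$ is a function $v\colon 2^N\to\mathbb R$ with $v(\varnothing)=0$. Write $v_i=v(\{i\})$ and $M_i(v)=v(N)-v(N\setminus\{i\})$ for $i\in N$. The game $v$ is standard if $v_i\leqslant M_i(v)$ for every $i\in N$ and $v_j<M_j(v)$ for at least one $j\in N$. For a standard game $v$ and $\alpha>0$, the $\alpha$-Gately value is $$g^\alpha_i(v)=v_i+\frac{(M_i(v)-v_i)^\alpha}{\sum_{j\in N}(M_j(v)-v_j)^\alpha}\Big(v(N)-\sum_{j\in N}v_j\Big),\qquad i\in N.$$ The game $v$ is $\alpha$-top dominant if for every coalition $S\subseteq N$ $$\Big[v(S)-\sum_{j\in S}v_j\Big]\cdot\sum_{j\in N}(M_j(v)-v_j)^\alpha\ \leqslant\ \Big[v(N)-\sum_{j\in N}v_j\Big]\cdot\sum_{j\in S}(M_j(v)-v_j)^\alpha .$$ The Core is $C(v)=\{x\in\mathbb R^N\mid \sum_{i\in N}x_i=v(N),\ \sum_{i\in S}x_i\geqslant v(S)\text{ for all }S\subseteq N\}$. *)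

theory Defs
  imports Complex_Main "HOL-Library.FuncSet"
begin

text \<open>
  A game on a finite player set \<open>N\<close> is a function on coalitions. It is represented by a total
  function \<open>'a set \<Rightarrow> real\<close>; only its values on subsets of \<open>N\<close> enter the definitions below.
\<close>

definition coop_game :: "'a set \<Rightarrow> ('a set \<Rightarrow> real) \<Rightarrow> bool" where
  "coop_game N v \<longleftrightarrow> finite N \<and> v {} = 0"

definition marginal :: "'a set \<Rightarrow> ('a set \<Rightarrow> real) \<Rightarrow> 'a \<Rightarrow> real" where
  "marginal N v i = v N - v (N - {i})"

definition standard_game :: "'a set \<Rightarrow> ('a set \<Rightarrow> real) \<Rightarrow> bool" where
  "standard_game N v \<longleftrightarrow> coop_game N v \<and>
     (\<forall>i\<in>N. v {i} \<le> marginal N v i) \<and> (\<exists>j\<in>N. v {j} < marginal N v j)"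

text \<open>
  The space \<open>\<real>\<^sup>N\<close> is \<open>N \<rightarrow>\<^sub>E UNIV\<close>: real functions on \<open>N\<close>, set to \<open>undefined\<close> outside \<open>N\<close>.
  For a standard game the bases of the powers are nonnegative, and
  \<open>0 powr \<alpha> = 0\<close> agrees with the usual power for \<open>\<alpha> > 0\<close>.
\<close>

definition gately_value :: "real \<Rightarrow> 'a set \<Rightarrow> ('a set \<Rightarrow> real) \<Rightarrow> 'a \<Rightarrow> real" where
  "gately_value \<alpha> N v = (\<lambda>i\<in>N.
     v {i} + (marginal N v i - v {i}) powr \<alpha> / (\<Sum>j\<in>N. (marginal N v j - v {j}) powr \<alpha>)
             * (v N - (\<Sum>j\<in>N. v {j})))"

definition top_dominant :: "real \<Rightarrow> 'a set \<Rightarrow> ('a set \<Rightarrow> real) \<Rightarrow> bool" where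
  "top_dominant \<alpha> N v \<longleftrightarrow> (\<forall>S\<subseteq>N.
     (v S - (\<Sum>j\<in>S. v {j})) * (\<Sum>j\<in>N. (marginal N v j - v {j}) powr \<alpha>)
     \<le> (v N - (\<Sum>j\<in>N. v {j})) * (\<Sum>j\<in>S. (marginal N v j - v {j}) powr \<alpha>))"

definition core :: "'a set \<Rightarrow> ('a set \<Rightarrow> real) \<Rightarrow> ('a \<Rightarrow> real) set" where
  "core N v = {x \<in> N \<rightarrow>\<^sub>E UNIV. (\<Sum>i\<in>N. x i) = v N \<and> (\<forall>S\<subseteq>N. (\<Sum>i\<in>S. x i) \<ge> v S)}"

end

theory Submission
  imports Defs
begin

text \<open>Write d(S) for the sum over S of the terms
  \<open>(marginal N v j - v {j}) powr \<alpha>\<close>. The value gives each player the singleton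
  worth plus a share of the surplus of N, so coalition S receives its singleton worths plus the
  fraction d(S)/d(N) of that surplus. Since d(N) > 0, multiplying the core inequality for S by d(N)
  turns it into the top dominance inequality for the same S. Efficiency is automatic, as the shares
  add up to 1.\<close>

lemma standard_game_sum_powr_pos:
  assumes "standard_game N v"
  shows "(\<Sum>j\<in>N. (marginal N v j - v {j}) powr \<alpha>) > 0"
proof -
  from assms obtain j where j: "j \<in> N" "v {j} < marginal N v j" and fin: "finite N"
    unfolding standard_game_def coop_game_def by blast
  from j have "(marginal N v j - v {j}) powr \<alpha> > 0"
    by simp
  \<comment> \<open>One positive term suffices, because \<open>powr\<close> is never negative on the
    reals.\<close>
  with fin j(1) show ?thesis
    by (intro sum_pos2[of N j]) simp_all
qed

lemma sum_gately_value:
  assumes "S \<subseteq> N"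
  shows "(\<Sum>i\<in>S. gately_value \<alpha> N v i) = (\<Sum>j\<in>S. v {j})
    + (v N - (\<Sum>j\<in>N. v {j})) * (\<Sum>j\<in>S. (marginal N v j - v {j}) powr \<alpha>)
      / (\<Sum>j\<in>N. (marginal N v j - v {j}) powr \<alpha>)"
proof -
  have "(\<Sum>i\<in>S. gately_value \<alpha> N v i) = (\<Sum>i\<in>S. v {i} + (v N - (\<Sum>j\<in>N. v {j}))
      * (marginal N v i - v {i}) powr \<alpha> / (\<Sum>j\<in>N. (marginal N v j - v {j}) powr \<alpha>))"
    \<comment> \<open>The value is a restricted function, so its formula is available only at
      players of N; this is where \<open>S \<subseteq> N\<close> enters.\<close>
    using assms by (intro sum.cong) (auto simp: gately_value_def mult.commute)
  then show ?thesis
    by (simp add: sum.distrib sum_distrib_left sum_divide_distrib)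
qed

lemma top_dominant_iff_gately_value_in_core:
  assumes "standard_game N v"
  shows "top_dominant \<alpha> N v \<longleftrightarrow> gately_value \<alpha> N v \<in> core N v"
proof -
  let ?d = "\<lambda>S. \<Sum>j\<in>S. (marginal N v j - v {j}) powr \<alpha>"
  have pos: "?d N > 0"
    using assms by (rule standard_game_sum_powr_pos)
  have "gately_value \<alpha> N v \<in> N \<rightarrow>\<^sub>E UNIV"
    by (simp add: gately_value_def)
  \<comment> \<open>The case S = N: the factor d(N)/d(N) cancels and the singleton worths drop
    out.\<close>
  moreover have "(\<Sum>i\<in>N. gately_value \<alpha> N v i) = v N"
    using pos by (simp add: sum_gately_value)
  \<comment> \<open>The equivalence holds for each coalition separately, so quantifying over S
    yields the theorem.\<close>
  moreover have "v S \<le> (\<Sum>i\<in>S. gately_value \<alpha> N v i) \<longleftrightarrow>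
      (v S - (\<Sum>j\<in>S. v {j})) * ?d N \<le> (v N - (\<Sum>j\<in>N. v {j})) * ?d S" if "S \<subseteq> N" for S
  proof -
    have "v S \<le> (\<Sum>i\<in>S. gately_value \<alpha> N v i) \<longleftrightarrow>
        v S - (\<Sum>j\<in>S. v {j}) \<le> (v N - (\<Sum>j\<in>N. v {j})) * ?d S / ?d N"
      unfolding sum_gately_value[OF that] by linarith
    also have "\<dots> \<longleftrightarrow> (v S - (\<Sum>j\<in>S. v {j})) * ?d N \<le> (v N - (\<Sum>j\<in>N. v {j})) * ?d S"
      using pos by (rule pos_le_divide_eq)
    finally show ?thesis .
  qed
  ultimately show ?thesis
    unfolding top_dominant_def core_def by simp
qed

theorem theorem5p3:
  fixes n :: nat and N :: "nat set" and v :: "nat set \<Rightarrow> real" and \<alpha> :: real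
  assumes "N = {1..n}"
    and "\<alpha> > 0"
    and "standard_game N v"
  shows "top_dominant \<alpha> N v \<longleftrightarrow> gately_value \<alpha> N v \<in> core N v"
  using assms(3) by (rule top_dominant_iff_gately_value_in_core)

end
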